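(* Let $G$ be a metrisable topological group and let $d$ be a metrically proper compatible left-invariant metric on $G$. Then the following conditions are equivalent: (1) $d$ is maximal; (2) $(G,d)$ is large scale geodesic; (3) there is $\alpha>0$ so that $\Sigma=\{g\in G : d(g,1)\leqslant \alpha\}$ generates $G$ and $d$ is quasi-isometric to the word metric $\rho_\Sigma$.
   Context: A metrisable topological group is a topological group whose topology can be induced by some metric. A metric on $G$ is compatible if it induces the topology of $G$, and left-invariant if $d(hg,hf)=d(g,f)$ for all $g,f,h\in G$. A sequence $(g_n)$ in $G$ tends to infinity, written $g_n\to\infty$, if there is a compatible left-invariant metric $\partial$ with $\partial(g_n,1)\to\infty$. A compatible left-invariant metric $d$ is metrically proper if $d(g_n,1)\to\infty$ whenever $g_n\to\infty$. A compatible left-invariant metric $d$ is maximal if for every compatible left-invariant metric $\partial$ on $G$ there is a constant $K$ with $\partial\leqslant K\cdot d+K$. A metric space $(X,d)$ is large scale geodesic if there is $K\geqslant 1$ so that for all $x,y\in X$ there are $z_0=x,z_1,\ldots,z_n=y$ in $X$ with $d(z_i,z_{i+1})\leqslant K$ for all $i<n$ and $\sum_{i=0}^{n-1}d(z_i,z_{i+1})\leqslant K\cdot d(x,y)$. For a symmetric generating set $\Sigma$ of $G$, the word metric is $\rho_\Sigma(g,h)=\min\{k\geqslant 0 : \exists s_1,\ldots,s_k\in\Sigma,\ g=hs_1\cdots s_k\}$. Two metrics $d_1,d_2$ on $G$ are quasi-isometric if there is $K\geqslant 1$ with $\frac1K d_1-K\leqslant d_2\leqslant K d_1+K$. *)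

theory Defs
  imports "HOL-Analysis.Abstract_Metric_Spaces" "HOL-Algebra.Generated_Groups"
begin

locale topological_group = group G for G :: "('a, 'b) monoid_scheme" (structure) +
  fixes T :: "'a topology"
  assumes topspace_eq_carrier: "topspace T = carrier G"
    and continuous_map_mult: "continuous_map (prod_topology T T) T (\<lambda>(x, y). x \<otimes> y)"
    and continuous_map_inv: "continuous_map T T (\<lambda>x. inv x)"

locale metrisable_topological_group = topological_group G T
  for G :: "('a, 'b) monoid_scheme" (structure) and T :: "'a topology" +
  assumes metrizable: "metrizable_space T"

definition left_invariant :: "('a, 'b) monoid_scheme \<Rightarrow> ('a \<Rightarrow> 'a \<Rightarrow> real) \<Rightarrow> bool" where
  "left_invariant G d \<longleftrightarrow>
     (\<forall>g\<in>carrier G. \<forall>f\<in>carrier G. \<forall>h\<in>carrier G. d (h \<otimes>\<^bsub>G\<^esub> g) (h \<otimes>\<^bsub>G\<^esub> f) = d g f)"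

definition compatible_metric :: "'a topology \<Rightarrow> ('a \<Rightarrow> 'a \<Rightarrow> real) \<Rightarrow> bool" where
  "compatible_metric T d \<longleftrightarrow>
     Metric_space (topspace T) d \<and> Metric_space.mtopology (topspace T) d = T"

definition compatible_left_invariant ::
    "('a, 'b) monoid_scheme \<Rightarrow> 'a topology \<Rightarrow> ('a \<Rightarrow> 'a \<Rightarrow> real) \<Rightarrow> bool" where
  "compatible_left_invariant G T d \<longleftrightarrow> compatible_metric T d \<and> left_invariant G d"

definition tends_to_infinity ::
    "('a, 'b) monoid_scheme \<Rightarrow> 'a topology \<Rightarrow> (nat \<Rightarrow> 'a) \<Rightarrow> bool" where
  "tends_to_infinity G T g \<longleftrightarrow>
     (\<exists>\<delta>. compatible_left_invariant G T \<delta> \<and>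
          filterlim (\<lambda>n. \<delta> (g n) \<one>\<^bsub>G\<^esub>) at_top sequentially)"

definition metrically_proper ::
    "('a, 'b) monoid_scheme \<Rightarrow> 'a topology \<Rightarrow> ('a \<Rightarrow> 'a \<Rightarrow> real) \<Rightarrow> bool" where
  "metrically_proper G T d \<longleftrightarrow>
     (\<forall>g :: nat \<Rightarrow> 'a. range g \<subseteq> carrier G \<longrightarrow> tends_to_infinity G T g \<longrightarrow>
        filterlim (\<lambda>n. d (g n) \<one>\<^bsub>G\<^esub>) at_top sequentially)"

definition maximal_metric ::
    "('a, 'b) monoid_scheme \<Rightarrow> 'a topology \<Rightarrow> ('a \<Rightarrow> 'a \<Rightarrow> real) \<Rightarrow> bool" where
  "maximal_metric G T d \<longleftrightarrow>
     (\<forall>\<delta>. compatible_left_invariant G T \<delta> \<longrightarrow>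
        (\<exists>K::real. \<forall>g\<in>carrier G. \<forall>h\<in>carrier G. \<delta> g h \<le> K * d g h + K))"

definition large_scale_geodesic :: "'a set \<Rightarrow> ('a \<Rightarrow> 'a \<Rightarrow> real) \<Rightarrow> bool" where
  "large_scale_geodesic X d \<longleftrightarrow>
     (\<exists>K::real. K \<ge> 1 \<and>
        (\<forall>x\<in>X. \<forall>y\<in>X. \<exists>(n::nat) (z :: nat \<Rightarrow> 'a).
           z 0 = x \<and> z n = y \<and> (\<forall>i\<le>n. z i \<in> X) \<and>
           (\<forall>i<n. d (z i) (z (Suc i)) \<le> K) \<and>
           (\<Sum>i<n. d (z i) (z (Suc i))) \<le> K * d x y))"

text \<open>The value is the intended minimum only if \<open>h\<inverse>g\<close> is a product of elements of \<open>S\<close>,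
  as is the case for all \<open>g\<close>, \<open>h\<close> when \<open>S\<close> is symmetric and generates \<open>G\<close>;
  otherwise it is unspecified.\<close>

definition word_metric :: "('a, 'b) monoid_scheme \<Rightarrow> 'a set \<Rightarrow> 'a \<Rightarrow> 'a \<Rightarrow> nat" where
  "word_metric G S g h =
     (LEAST k. \<exists>ss. length ss = k \<and> set ss \<subseteq> S \<and>
        g = h \<otimes>\<^bsub>G\<^esub> foldr (\<lambda>s t. s \<otimes>\<^bsub>G\<^esub> t) ss \<one>\<^bsub>G\<^esub>)"

definition quasi_isometric_metrics ::
    "'a set \<Rightarrow> ('a \<Rightarrow> 'a \<Rightarrow> real) \<Rightarrow> ('a \<Rightarrow> 'a \<Rightarrow> real) \<Rightarrow> bool" where
  "quasi_isometric_metrics X d1 d2 \<longleftrightarrow>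
     (\<exists>K::real. K \<ge> 1 \<and>
        (\<forall>x\<in>X. \<forall>y\<in>X. 1 / K * d1 x y - K \<le> d2 x y \<and> d2 x y \<le> K * d1 x y + K))"

end

theory Submission imports Defs
begin

text \<open>
  A word over the ball \<open>\<Sigma>\<close> is a chain of bounded steps, so (2) gives (3) once consecutive short
  steps of a chain are merged until each merged step is longer than the bound \<open>K\<close> of (2).
  For (3) to (1), metric properness makes any compatible left-invariant metric bounded on \<open>\<Sigma>\<close>,
  hence linearly bounded by the word metric.

  For (1) to (2), let \<open>\<delta>\<close> be the largest metric with \<open>\<delta> \<le> max d d\<^sup>2\<close>, i.e. the infimum of
  the sums of \<open>max d d\<^sup>2\<close> along chains. It agrees with \<open>d\<close> at small distances, so it is compatible
  and left-invariant, and maximality gives \<open>\<delta> \<le> K d + K\<close>. Hence two points at a large distance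
  \<open>D\<close> are joined by a chain whose cost is \<open>O(D)\<close>. The quadratic cost of a long step of length
  \<open>t\<close> forces \<open>t \<le> D / 2\<close> and pays for its replacement by a chain of bounded steps of length
  \<open>O(t)\<close>, which exists by induction on the scale \<open>D\<close>.
\<close>

section \<open>Weighted chains\<close>

text \<open>Carrying the total weight as an index lets induction replace sums over finite sequences.
  Two instances matter: steps of bounded length weighted by \<open>d\<close>, and arbitrary steps
  weighted by \<open>quadratic_cost\<close>.\<close>

inductive chain :: "('a \<Rightarrow> 'a \<Rightarrow> bool) \<Rightarrow> ('a \<Rightarrow> 'a \<Rightarrow> real) \<Rightarrow> 'a \<Rightarrow> 'a \<Rightarrow> real \<Rightarrow> bool"
  for R w x where
  chain_refl: "chain R w x x 0"
| chain_step: "chain R w x y L \<Longrightarrow> R y z \<Longrightarrow> chain R w x z (L + w y z)"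

lemma chain_single: "R x y \<Longrightarrow> chain R w x y (w x y)"
  using chain_step[OF chain_refl, of R x y w] by simp

text \<open>Chains grow at their right end, so the induction runs over the second piece, which is
  therefore the first premise.\<close>

lemma chain_trans:
  assumes "chain R w y z L'" "chain R w x y L"
  shows "chain R w x z (L + L')"
  using assms
proof (induction rule: chain.induct)
  case (chain_step u L' v)
  then show ?case
    using chain.chain_step[of R w x u "L + L'" v] by (simp add: add.assoc)
qed simp

lemma chain_sym:
  assumes "chain R w x y L" and "\<And>x y. R x y \<Longrightarrow> R y x" and "\<And>x y. w x y = w y x"
  shows "chain R w y x L"
  using assms(1)
proof (induction rule: chain.induct)
  case (chain_step y L z)
  then have "chain R w z y (w z y)"
    using chain_single assms(2) by metis
  then show ?case
    using chain_trans[OF chain_step.IH] assms(3)[of y z] by (metis add.commute)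
qed (rule chain_refl)

lemma chain_map:
  assumes "chain R w x y L"
    and "\<And>x y. R x y \<Longrightarrow> R (f x) (f y)" and "\<And>x y. R x y \<Longrightarrow> w (f x) (f y) = w x y"
  shows "chain R w (f x) (f y) L"
  using assms(1)
proof (induction rule: chain.induct)
  case (chain_step y L z)
  then show ?case
    using chain.chain_step[of R w "f x" "f y" L "f z"] assms(2,3) by simp
qed (rule chain_refl)

lemma chain_nonneg:
  assumes "chain R w x y L" "\<And>x y. w x y \<ge> 0"
  shows "L \<ge> 0"
  using assms(1) by induction (use assms(2) in auto)

text \<open>Bridge to the sequences in \<open>large_scale_geodesic\<close>; \<open>x \<in> X\<close>
  covers the empty chain.\<close>

lemma chain_iff_sequence:
  assumes "x \<in> X"
  shows "chain (\<lambda>x y. x \<in> X \<and> y \<in> X \<and> d x y \<le> K) d x y L \<longleftrightarrow>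
    (\<exists>(n::nat) z. z 0 = x \<and> z n = y \<and> (\<forall>i\<le>n. z i \<in> X) \<and>
       (\<forall>i<n. d (z i) (z (Suc i)) \<le> K) \<and> (\<Sum>i<n. d (z i) (z (Suc i))) = L)"
    (is "chain ?R d x y L \<longleftrightarrow> ?seq y L")
proof
  assume "chain ?R d x y L"
  then show "?seq y L"
  proof induction
    case chain_refl
    show ?case
      by (rule exI[of _ 0], rule exI[of _ "\<lambda>_. x"]) (use assms in auto)
  next
    case (chain_step y L u)
    then obtain n z where z: "z 0 = x" "z n = y" "\<forall>i\<le>n. z i \<in> X"
      "\<forall>i<n. d (z i) (z (Suc i)) \<le> K" "(\<Sum>i<n. d (z i) (z (Suc i))) = L"
      by auto
    show ?case
      by (rule exI[of _ "Suc n"], rule exI[of _ "z(Suc n := u)"])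
        (use z chain_step in \<open>auto simp: less_Suc_eq le_Suc_eq\<close>)
  qed
next
  assume "?seq y L"
  then obtain n z where z: "z 0 = x" "z n = y" "\<forall>i\<le>n. z i \<in> X"
      "\<forall>i<n. d (z i) (z (Suc i)) \<le> K" "(\<Sum>i<n. d (z i) (z (Suc i))) = L"
    by auto
  have "chain ?R d x (z m) (\<Sum>i<m. d (z i) (z (Suc i)))" if "m \<le> n" for m
    using that
  proof (induction m)
    case 0
    then show ?case using z chain_refl by simp
  next
    case (Suc m)
    then have "?R (z m) (z (Suc m))"
      using z by simp
    then show ?case
      using Suc chain_step[of ?R d x "z m"] by simp
  qed
  then show "chain ?R d x y L"
    using z by auto
qed

lemma large_scale_geodesic_iff_chain:
  "large_scale_geodesic X d \<longleftrightarrow>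
    (\<exists>K\<ge>1. \<forall>x\<in>X. \<forall>y\<in>X. \<exists>L\<le>K * d x y. chain (\<lambda>x y. x \<in> X \<and> y \<in> X \<and> d x y \<le> K) d x y L)"
  unfolding large_scale_geodesic_def
  by (intro ex_cong1 conj_cong ball_cong refl) (auto simp: chain_iff_sequence)

section \<open>The chain metric of a superlinear cost\<close>

context Metric_space
begin

text \<open>The square violates the triangle inequality in general, so this cost becomes a metric
  only after passing to chains.\<close>

definition quadratic_cost :: "'a \<Rightarrow> 'a \<Rightarrow> real" where
  "quadratic_cost x y = max (d x y) ((d x y)\<^sup>2)"

abbreviation cost_chain :: "'a \<Rightarrow> 'a \<Rightarrow> real \<Rightarrow> bool" where
  "cost_chain \<equiv> chain (\<lambda>x y. x \<in> M \<and> y \<in> M) quadratic_cost"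

text \<open>The locale demands symmetry and nonnegativity also outside \<open>M\<close>, whence the case
  distinction.\<close>

definition chain_metric :: "'a \<Rightarrow> 'a \<Rightarrow> real" where
  "chain_metric x y = (if x \<in> M \<and> y \<in> M then Inf {L. cost_chain x y L} else 0)"

lemma quadratic_cost_nonneg: "quadratic_cost x y \<ge> 0"
  by (simp add: quadratic_cost_def le_max_iff_disj)

lemma quadratic_cost_commute: "quadratic_cost x y = quadratic_cost y x"
  by (simp add: quadratic_cost_def commute)

lemma quadratic_cost_small: "d x y \<le> 1 \<Longrightarrow> quadratic_cost x y = d x y"
  by (simp add: quadratic_cost_def power2_eq_square mult_left_le max_absorb1)

lemma cost_chain_ge:
  assumes "cost_chain x y L" "x \<in> M"
  shows "d x y \<le> L"
  using assms
proof induction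
  case chain_refl
  then show ?case using zero by simp
next
  case (chain_step y L z)
  have "d x z \<le> d x y + d y z"
    using chain_step triangle by blast
  also have "d y z \<le> quadratic_cost y z"
    by (simp add: quadratic_cost_def)
  finally show ?case
    using chain_step by simp
qed

lemma chain_metric_le:
  assumes "cost_chain x y L" "x \<in> M" "y \<in> M"
  shows "chain_metric x y \<le> L"
proof -
  have "bdd_below {L. cost_chain x y L}"
    by (rule bdd_belowI[of _ 0]) (auto dest: chain_nonneg intro: quadratic_cost_nonneg)
  then show ?thesis
    using assms by (auto simp: chain_metric_def intro: cInf_lower)
qed

lemma chain_metric_greatest:
  assumes "\<And>L. cost_chain x y L \<Longrightarrow> b \<le> L" "x \<in> M" "y \<in> M"
  shows "b \<le> chain_metric x y"
proof -
  \<comment> \<open>The one-step chain shows that the infimum is over a nonempty set.\<close>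
  have "cost_chain x y (quadratic_cost x y)"
    using assms by (intro chain_single) auto
  then have "b \<le> Inf {L. cost_chain x y L}"
    using assms(1) by (intro cInf_greatest) auto
  then show ?thesis
    using assms by (simp add: chain_metric_def)
qed

lemma chain_metric_ge: "x \<in> M \<Longrightarrow> y \<in> M \<Longrightarrow> d x y \<le> chain_metric x y"
  by (rule chain_metric_greatest) (auto intro: cost_chain_ge)

lemma chain_metric_le_cost: "x \<in> M \<Longrightarrow> y \<in> M \<Longrightarrow> chain_metric x y \<le> quadratic_cost x y"
  by (intro chain_metric_le chain_single) auto

lemma Metric_space_chain_metric: "Metric_space M chain_metric"
proof
  fix x y
  show "0 \<le> chain_metric x y"
  proof (cases "x \<in> M \<and> y \<in> M")
    case True
    then show ?thesis
      using nonneg chain_metric_ge by (meson order_trans)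
  qed (auto simp: chain_metric_def)
  have "cost_chain x y = cost_chain y x"
    by (intro ext iffI; erule chain_sym) (blast intro: quadratic_cost_commute)+
  then show "chain_metric x y = chain_metric y x"
    by (simp add: chain_metric_def conj_commute)
next
  fix x y assume xy: "x \<in> M" "y \<in> M"
  then have "d x y \<le> chain_metric x y" "chain_metric x y \<le> quadratic_cost x y"
    by (auto intro: chain_metric_ge chain_metric_le_cost)
  moreover have "quadratic_cost x y = 0" if "d x y = 0"
    using that by (simp add: quadratic_cost_def)
  ultimately show "chain_metric x y = 0 \<longleftrightarrow> x = y"
    using zero[OF xy] nonneg[of x y] by (metis order_antisym)
next
  fix x y z assume M: "x \<in> M" "y \<in> M" "z \<in> M"
  \<comment> \<open>The two infima are taken in turn: first over chains from \<open>x\<close> to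
    \<open>y\<close> with the chain from \<open>y\<close> to \<open>z\<close> fixed, then over the
    latter.\<close>
  have "chain_metric x z - chain_metric x y \<le> L'" if L': "cost_chain y z L'" for L'
  proof -
    have "chain_metric x z - L' \<le> L" if "cost_chain x y L" for L
      using chain_metric_le[OF chain_trans[OF L' that]] M by simp
    then show ?thesis
      using chain_metric_greatest[of x y "chain_metric x z - L'"] M by fastforce
  qed
  then show "chain_metric x z \<le> chain_metric x y + chain_metric y z"
    using chain_metric_greatest[of y z "chain_metric x z - chain_metric x y"] M by fastforce
qed

lemma mtopology_chain_metric: "Metric_space.mtopology M chain_metric = mtopology"
proof -
  interpret C: Metric_space M chain_metric
    by (rule Metric_space_chain_metric)
  have sub: "C.mball x r \<subseteq> mball x r" for x r
    using chain_metric_ge by (fastforce simp: C.in_mball in_mball)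
  \<comment> \<open>Capping the radius at 1 stays within the distances where a single step costs
    just \<open>d\<close>.\<close>
  have sup: "mball x (min r 1) \<subseteq> C.mball x r" for x r
    using chain_metric_le_cost quadratic_cost_small by (fastforce simp: C.in_mball in_mball)
  show ?thesis
  proof (rule topology_eq[THEN iffD2], intro allI)
    fix U
    have "(\<exists>r>0. C.mball x r \<subseteq> U) \<longleftrightarrow> (\<exists>r>0. mball x r \<subseteq> U)" for x
    proof
      assume "\<exists>r>0. C.mball x r \<subseteq> U"
      then obtain r where "r > 0" "C.mball x r \<subseteq> U" by blast
      then show "\<exists>r>0. mball x r \<subseteq> U"
        using sup[of x r] by (intro exI[of _ "min r 1"]) auto
    qed (use sub in blast)
    then show "openin C.mtopology U \<longleftrightarrow> openin mtopology U"
      by (simp add: C.openin_mtopology openin_mtopology)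
  qed
qed

section \<open>Bounded chains from a linear bound on the chain metric\<close>

lemma large_scale_geodesic_if_chain_metric_le:
  assumes bound: "\<And>x y. x \<in> M \<Longrightarrow> y \<in> M \<Longrightarrow> chain_metric x y \<le> K * d x y + K" and "K \<ge> 0"
  shows "large_scale_geodesic M d"
proof -
  \<comment> \<open>If \<open>d x y \<ge> 1\<close>, a nearly optimal chain costs at most
    \<open>(2 * K + 1) * d x y\<close>. The extra factor 2 rewrites this as
    \<open>A * (d x y / 2)\<close>, so that steps longer than \<open>A\<close> have at most half the
    length \<open>d x y\<close>.\<close>
  define A where "A = 2 * (2 * K + 1)"
  have "A \<ge> 1"
    using \<open>K \<ge> 0\<close> by (simp add: A_def)
  let ?R = "\<lambda>x y. x \<in> M \<and> y \<in> M \<and> d x y \<le> A"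
  have short: "\<exists>L\<le>A * d x y. chain ?R d x y L" if "x \<in> M" "y \<in> M" "d x y \<le> A" for x y
    using that chain_single[of ?R x y d] mult_right_mono[OF \<open>A \<ge> 1\<close> nonneg[of x y]] by auto
  \<comment> \<open>Induction over dyadic scales; at \<open>n = 0\<close> a single step
    suffices.\<close>
  have main: "\<exists>L\<le>A * d x y. chain ?R d x y L" if "x \<in> M" "y \<in> M" "d x y \<le> A * 2 ^ n" for x y n
    using that
  proof (induction n arbitrary: x y)
    case 0
    then show ?case
      using short by simp
  next
    case (Suc n)
    show ?case
    proof (cases "d x y \<le> A")
      case True
      then show ?thesis
        using short Suc.prems by blast
    next
      case False
      then have "d x y \<ge> 1"
        using \<open>A \<ge> 1\<close> by simp
      \<comment> \<open>The summand 1 is slack, since the infimum need not be attained.\<close>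
      have "\<exists>S. cost_chain x y S \<and> S < K * d x y + K + 1"
        using chain_metric_greatest[of x y "K * d x y + K + 1"] bound[of x y] Suc.prems
        by force
      then obtain S where S: "cost_chain x y S" "S < K * d x y + K + 1"
        by blast
      have "S \<le> K * d x y + K * d x y + d x y"
        using S(2) mult_left_mono[OF \<open>d x y \<ge> 1\<close> \<open>K \<ge> 0\<close>] \<open>d x y \<ge> 1\<close> by simp
      then have S_le: "S \<le> A * (d x y / 2)"
        by (simp add: A_def algebra_simps)
      \<comment> \<open>Each step of the cheap chain is exchanged for bounded steps of total length
        at most its cost. The condition \<open>S' \<le> S\<close> keeps the cost of each single step
        below \<open>S\<close>.\<close>
      have replace: "\<exists>L\<le>S'. chain ?R d x u L" if "cost_chain x u S'" "S' \<le> S" for u S'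
        using that
      proof induction
        case chain_refl
        then show ?case
          by (intro exI[of _ 0]) (simp add: chain.chain_refl)
      next
        case (chain_step u S' v)
        have "S' \<ge> 0"
          using chain_step.hyps(1) by (rule chain_nonneg) (rule quadratic_cost_nonneg)
        obtain L where L: "L \<le> S'" "chain ?R d x u L"
          using chain_step quadratic_cost_nonneg[of u v] by force
        have "\<exists>L'\<le>quadratic_cost u v. chain ?R d u v L'"
        proof (cases "d u v \<le> A")
          case True
          then show ?thesis
            using chain_single[of ?R u v d] chain_step.hyps
            by (intro exI[of _ "d u v"]) (simp add: quadratic_cost_def)
        next
          case False
          \<comment> \<open>This bound is used twice: it limits the length of the step, so that the
            induction hypothesis applies, and it pays for the chain obtained, of length at most
            \<open>A * d u v\<close>.\<close>
          then have A_le: "A * d u v \<le> quadratic_cost u v"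
            by (simp add: quadratic_cost_def power2_eq_square le_max_iff_disj mult_right_mono)
          also have "\<dots> \<le> A * (d x y / 2)"
            using chain_step.prems S_le \<open>S' \<ge> 0\<close> by simp
          finally have "d u v \<le> d x y / 2"
            using \<open>A \<ge> 1\<close> by simp
          then have "d u v \<le> A * 2 ^ n"
            using Suc.prems by simp
          then show ?thesis
            using Suc.IH[of u v] chain_step.hyps A_le by (meson order_trans)
        qed
        then show ?case
          using chain_trans L by (meson add_mono)
      qed
      have "0 \<le> A * d x y"
        using \<open>A \<ge> 1\<close> by simp
      then have "S \<le> A * d x y"
        using S_le by linarith
      then show ?thesis
        using replace[OF S(1) order_refl] order_trans by blast
    qed
  qed
  have "\<exists>L\<le>A * d x y. chain ?R d x y L" if "x \<in> M" "y \<in> M" for x y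
  proof -
    obtain n where "d x y < 2 ^ n"
      using real_arch_pow[of 2 "d x y"] by auto
    also have "(2::real) ^ n \<le> A * 2 ^ n"
      using \<open>A \<ge> 1\<close> by simp
    finally show ?thesis
      using main[OF that less_imp_le] by blast
  qed
  then show ?thesis
    unfolding large_scale_geodesic_iff_chain using \<open>A \<ge> 1\<close> by blast
qed

end

section \<open>Left-invariant metrics and words\<close>

context group
begin

abbreviation word_prod :: "'a list \<Rightarrow> 'a" where
  "word_prod ss \<equiv> foldr (\<lambda>s t. s \<otimes> t) ss \<one>"

lemma word_prod_closed: "set ss \<subseteq> carrier G \<Longrightarrow> word_prod ss \<in> carrier G"
  by (induction ss) auto

lemma word_prod_append:
  "set ss \<subseteq> carrier G \<Longrightarrow> set ts \<subseteq> carrier G \<Longrightarrow>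
    word_prod (ss @ ts) = word_prod ss \<otimes> word_prod ts"
  by (induction ss) (auto simp: word_prod_closed m_assoc)

lemma word_prod_in_generate: "set ss \<subseteq> S \<Longrightarrow> word_prod ss \<in> generate G S"
  by (induction ss) (auto intro: generate.intros)

lemma generate_imp_word:
  assumes "g \<in> generate G S" "S \<subseteq> carrier G" "\<And>s. s \<in> S \<Longrightarrow> inv s \<in> S"
  shows "\<exists>ss. set ss \<subseteq> S \<and> g = word_prod ss"
  using assms(1)
proof induction
  case one
  show ?case by (rule exI[of _ "[]"]) simp
next
  case (incl h)
  then show ?case using assms(2) by (intro exI[of _ "[h]"]) auto
next
  case (inv h)
  then show ?case using assms(2,3) by (intro exI[of _ "[inv h]"]) auto
next
  case (eng g h)
  then obtain ss ts where "set ss \<subseteq> S" "g = word_prod ss" "set ts \<subseteq> S" "h = word_prod ts"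
    by blast
  then show ?case
    using assms(2) by (intro exI[of _ "ss @ ts"]) (auto simp: word_prod_append simp del: foldr_append)
qed

text \<open>\<open>LEAST\<close> is meaningful only if some word exists; the premises supply
  one.\<close>

lemma word_metric_attained:
  assumes "set ss \<subseteq> S" "g = h \<otimes> word_prod ss"
  obtains ts where "length ts = word_metric G S g h" "set ts \<subseteq> S" "g = h \<otimes> word_prod ts"
  using LeastI[of "\<lambda>k. \<exists>ss. length ss = k \<and> set ss \<subseteq> S \<and> g = h \<otimes> word_prod ss" "length ss"] assms
  unfolding word_metric_def by blast

lemma word_metric_le:
  "set ss \<subseteq> S \<Longrightarrow> g = h \<otimes> word_prod ss \<Longrightarrow> word_metric G S g h \<le> length ss"
  unfolding word_metric_def by (rule Least_le) blast

end

text \<open>Interpreted for \<open>d\<close> and again for the competing metric in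
  \<open>word_metric_imp_maximal\<close>.\<close>

locale left_invariant_metric = group G + Metric_space "carrier G" d
  for G :: "('a, 'b) monoid_scheme" (structure) and d +
  assumes left_invariant: "left_invariant G d"
begin

lemma translate:
  "g \<in> carrier G \<Longrightarrow> f \<in> carrier G \<Longrightarrow> h \<in> carrier G \<Longrightarrow> d (h \<otimes> g) (h \<otimes> f) = d g f"
  using left_invariant by (simp add: left_invariant_def)

lemma inv_mult_one: "g \<in> carrier G \<Longrightarrow> h \<in> carrier G \<Longrightarrow> d (inv h \<otimes> g) \<one> = d g h"
  using translate[of g h "inv h"] by simp

lemma inv_one: "g \<in> carrier G \<Longrightarrow> d (inv g) \<one> = d g \<one>"
  using inv_mult_one[of \<one> g] by (simp add: commute)

text \<open>The prefixes of a word form a chain whose steps, by left invariance, are as long as its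
  letters. Applied to \<open>d\<close> for the quasi-isometry and to the competing metric for
  maximality.\<close>

lemma word_prod_le:
  assumes "set ss \<subseteq> S" "S \<subseteq> carrier G" "\<And>s. s \<in> S \<Longrightarrow> d s \<one> \<le> B" "h \<in> carrier G"
  shows "d (h \<otimes> word_prod ss) h \<le> B * length ss"
proof -
  have "d (word_prod ss) \<one> \<le> B * length ss"
    using assms(1)
  proof (induction ss)
    case (Cons s ss)
    have "s \<in> carrier G" "word_prod ss \<in> carrier G"
      using Cons.prems assms(2) by (auto intro!: word_prod_closed)
    then have "d (s \<otimes> word_prod ss) \<one> \<le> d (word_prod ss) \<one> + d s \<one>"
      using triangle[of "s \<otimes> word_prod ss" s \<one>] translate[of "word_prod ss" \<one> s] by simp
    then show ?case
      using Cons assms(3)[of s] by (simp add: algebra_simps)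
  qed simp
  then show ?thesis
    using translate[of "word_prod ss" \<one> h] assms word_prod_closed[of ss] by simp
qed

section \<open>From maximality to large scale geodesicity\<close>

text \<open>Translations preserve the cost of chains; translating back by the inverse upgrades the
  inequality to equality.\<close>

lemma left_invariant_chain_metric: "left_invariant G chain_metric"
proof -
  have le: "chain_metric (h \<otimes> g) (h \<otimes> f) \<le> chain_metric g f"
    if "g \<in> carrier G" "f \<in> carrier G" "h \<in> carrier G" for g f h
  proof (rule chain_metric_greatest)
    fix L assume "cost_chain g f L"
    then have "cost_chain (h \<otimes> g) (h \<otimes> f) L"
      by (rule chain_map) (use that in \<open>auto simp: quadratic_cost_def translate\<close>)
    then show "chain_metric (h \<otimes> g) (h \<otimes> f) \<le> L"
      using that by (intro chain_metric_le) auto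
  qed (use that in auto)
  show ?thesis
    unfolding left_invariant_def
  proof (intro ballI antisym le)
    fix g f h assume "g \<in> carrier G" "f \<in> carrier G" "h \<in> carrier G"
    then show "chain_metric g f \<le> chain_metric (h \<otimes> g) (h \<otimes> f)"
      using le[of "h \<otimes> g" "h \<otimes> f" "inv h"] by (simp flip: m_assoc)
  qed
qed

lemma maximal_imp_large_scale_geodesic:
  assumes "maximal_metric G mtopology d"
  shows "large_scale_geodesic (carrier G) d"
proof -
  have "compatible_left_invariant G mtopology chain_metric"
    by (simp add: compatible_left_invariant_def compatible_metric_def Metric_space_chain_metric
        mtopology_chain_metric left_invariant_chain_metric)
  then obtain K where
    K: "\<forall>g\<in>carrier G. \<forall>h\<in>carrier G. chain_metric g h \<le> K * d g h + K"
    using assms by (auto simp: maximal_metric_def)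
  show ?thesis
  proof (rule large_scale_geodesic_if_chain_metric_le)
    fix g h assume "g \<in> carrier G" "h \<in> carrier G"
    then have "chain_metric g h \<le> K * d g h + K"
      using K by blast
    \<comment> \<open>Maximality may deliver a negative \<open>K\<close>, while the chain argument
      asks for a nonnegative one.\<close>
    also have "\<dots> \<le> max K 0 * d g h + max K 0"
      by (intro add_mono mult_right_mono) auto
    finally show "chain_metric g h \<le> max K 0 * d g h + max K 0" .
  qed simp
qed

section \<open>From large scale geodesicity to the word metric\<close>

text \<open>Greedy merging: the word lags behind the end of the chain by at most \<open>K\<close>. A
  letter is appended only when the lag would exceed \<open>K\<close>; it is then still at most
  \<open>2 * K\<close>, and the lag drops to 0. Each letter uses up more than \<open>K\<close> of
  the chain's length, so many tiny steps do no harm.\<close>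

lemma chain_imp_word:
  assumes "chain (\<lambda>x y. x \<in> carrier G \<and> y \<in> carrier G \<and> d x y \<le> K) d h y L"
    and "h \<in> carrier G" "K \<ge> 0"
  shows "\<exists>ss. set ss \<subseteq> {g \<in> carrier G. d g \<one> \<le> 2 * K} \<and> d (h \<otimes> word_prod ss) y \<le> K \<and>
    real (length ss) * K + d (h \<otimes> word_prod ss) y \<le> L"
  using assms(1)
proof induction
  case chain_refl
  show ?case
    using assms(2,3) by (intro exI[of _ "[]"]) simp
next
  case (chain_step y L z)
  then obtain ss where ss: "set ss \<subseteq> {g \<in> carrier G. d g \<one> \<le> 2 * K}"
    "d (h \<otimes> word_prod ss) y \<le> K" "real (length ss) * K + d (h \<otimes> word_prod ss) y \<le> L"
    by blast
  define p where "p = h \<otimes> word_prod ss"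
  have ss_carrier: "set ss \<subseteq> carrier G"
    using ss by auto
  then have p: "p \<in> carrier G"
    using assms(2) word_prod_closed by (simp add: p_def)
  have pz: "d p z \<le> d p y + d y z"
    using chain_step p triangle by blast
  show ?case
  proof (cases "d p z \<le> K")
    case True
    then show ?thesis
      using ss pz by (intro exI[of _ ss]) (simp flip: p_def)
  next
    case False
    let ?s = "inv p \<otimes> z"
    have s: "?s \<in> carrier G" "d ?s \<one> \<le> 2 * K"
      using p chain_step pz ss(2) inv_mult_one[of z p] by (auto simp: commute simp flip: p_def)
    have "h \<otimes> word_prod (ss @ [?s]) = p \<otimes> ?s"
      using s assms(2) ss_carrier word_prod_closed[of ss]
      by (simp add: word_prod_append p_def m_assoc del: foldr_append)
    also have "\<dots> = z"
      using p chain_step by (simp flip: m_assoc)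
    finally have eq: "h \<otimes> word_prod (ss @ [?s]) = z" .
    have "d z z = 0"
      using chain_step zero by simp
    moreover have "real (length (ss @ [?s])) * K \<le> L + d y z"
      using False ss(3) pz by (simp add: algebra_simps flip: p_def)
    ultimately show ?thesis
      using s ss(1) assms(3) eq
      by (intro exI[of _ "ss @ [?s]"] conjI) (auto simp del: foldr_append)
  qed
qed

lemma large_scale_geodesic_imp_word_metric:
  assumes "large_scale_geodesic (carrier G) d"
  obtains \<alpha> where "\<alpha> > 0" "generate G {g \<in> carrier G. d g \<one> \<le> \<alpha>} = carrier G"
    "quasi_isometric_metrics (carrier G) d
      (\<lambda>g h. real (word_metric G {g \<in> carrier G. d g \<one> \<le> \<alpha>} g h))"
proof -
  obtain K where K: "K \<ge> 1" "\<And>x y. x \<in> carrier G \<Longrightarrow> y \<in> carrier G \<Longrightarrow>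
      \<exists>L\<le>K * d x y. chain (\<lambda>x y. x \<in> carrier G \<and> y \<in> carrier G \<and> d x y \<le> K) d x y L"
    using assms unfolding large_scale_geodesic_iff_chain by blast
  define S where "S = {g \<in> carrier G. d g \<one> \<le> 2 * K}"
  have S: "S \<subseteq> carrier G"
    by (auto simp: S_def)
  \<comment> \<open>Merging gives at most \<open>L / K \<le> d h g\<close> letters, as
    \<open>K\<close> is both step bound and length factor; one last letter closes the remaining lag,
    whence the \<open>+ 1\<close>.\<close>
  have word: "\<exists>ss. set ss \<subseteq> S \<and> g = h \<otimes> word_prod ss \<and> length ss \<le> d g h + 1"
    if gh: "g \<in> carrier G" "h \<in> carrier G" for g h
  proof -
    obtain L where L: "L \<le> K * d h g"
      "chain (\<lambda>x y. x \<in> carrier G \<and> y \<in> carrier G \<and> d x y \<le> K) d h g L"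
      using K gh by blast
    obtain ss where ss: "set ss \<subseteq> S" "d (h \<otimes> word_prod ss) g \<le> K"
      "real (length ss) * K + d (h \<otimes> word_prod ss) g \<le> L"
      using chain_imp_word[OF L(2)] K gh unfolding S_def by force
    define p where "p = h \<otimes> word_prod ss"
    have ss_carrier: "set ss \<subseteq> carrier G"
      using ss S by auto
    then have p: "p \<in> carrier G"
      using gh word_prod_closed by (simp add: p_def)
    let ?s = "inv p \<otimes> g"
    have s: "?s \<in> carrier G" "?s \<in> S"
      using p gh K ss(2) inv_mult_one[of g p] by (auto simp: S_def commute simp flip: p_def)
    have "h \<otimes> word_prod (ss @ [?s]) = p \<otimes> ?s"
      using s gh ss_carrier word_prod_closed[of ss]
      by (simp add: word_prod_append p_def m_assoc del: foldr_append)
    also have "\<dots> = g"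
      using p gh by (simp flip: m_assoc)
    finally have eq: "g = h \<otimes> word_prod (ss @ [?s])" ..
    have "K * real (length ss) \<le> K * d g h"
      using ss(3) L(1) nonneg[of g "h \<otimes> word_prod ss"]
      by (simp add: mult.commute commute del: nonneg)
    then have "length ss \<le> d g h"
      using K(1) by simp
    then show ?thesis
      using s ss(1) eq by (intro exI[of _ "ss @ [?s]"] conjI) (auto simp del: foldr_append)
  qed
  have "generate G S = carrier G"
  proof
    show "carrier G \<subseteq> generate G S"
    proof
      fix g assume "g \<in> carrier G"
      then obtain ss where "set ss \<subseteq> S" "g = \<one> \<otimes> word_prod ss"
        using word[of g \<one>] by auto
      then show "g \<in> generate G S"
        using word_prod_in_generate[of ss S] word_prod_closed[of ss] S by simp
    qed
  qed (rule generate_incl[OF S])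
  moreover have "quasi_isometric_metrics (carrier G) d (\<lambda>g h. real (word_metric G S g h))"
    unfolding quasi_isometric_metrics_def
  \<comment> \<open>\<open>2 * K\<close> bounds the length of a letter, which yields the lower
    estimate; the upper one follows from \<open>word\<close> with room to spare.\<close>
  proof (intro exI[of _ "2 * K"] conjI ballI)
    fix g h assume gh: "g \<in> carrier G" "h \<in> carrier G"
    then obtain ss where ss: "set ss \<subseteq> S" "g = h \<otimes> word_prod ss" "length ss \<le> d g h + 1"
      using word by blast
    then have "real (word_metric G S g h) \<le> d g h + 1"
      using word_metric_le[of ss S g h] by simp
    also have "\<dots> \<le> 2 * K * d g h + 2 * K"
      using K(1) mult_right_mono[of 1 "2 * K" "d g h"] by simp
    finally show "real (word_metric G S g h) \<le> 2 * K * d g h + 2 * K" .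
    obtain ts where ts: "length ts = word_metric G S g h" "set ts \<subseteq> S" "g = h \<otimes> word_prod ts"
      using word_metric_attained[OF ss(1,2)] .
    have "d (h \<otimes> word_prod ts) h \<le> 2 * K * length ts"
      by (rule word_prod_le[OF ts(2) S _ gh(2)]) (simp add: S_def)
    then have "d g h \<le> 2 * K * word_metric G S g h"
      unfolding ts(1) ts(3)[symmetric] .
    then have "1 / (2 * K) * d g h \<le> word_metric G S g h"
      using K(1) by (simp add: field_simps)
    then show "1 / (2 * K) * d g h - 2 * K \<le> word_metric G S g h"
      using K(1) by simp
  qed (use K in simp)
  ultimately show ?thesis
    using that[of "2 * K"] K(1) by (simp add: S_def)
qed

section \<open>From the word metric back to maximality\<close>

lemma word_metric_imp_maximal:
  assumes proper: "metrically_proper G T d"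
    and gen: "generate G {g \<in> carrier G. d g \<one> \<le> \<alpha>} = carrier G"
    and qi: "quasi_isometric_metrics (carrier G) d
      (\<lambda>g h. real (word_metric G {g \<in> carrier G. d g \<one> \<le> \<alpha>} g h))"
    and T: "topspace T = carrier G"
  shows "maximal_metric G T d"
  unfolding maximal_metric_def
proof (intro allI impI)
  fix \<delta> assume \<delta>: "compatible_left_invariant G T \<delta>"
  then interpret D: left_invariant_metric G \<delta>
    by (simp add: left_invariant_metric_def left_invariant_metric_axioms_def group_axioms
        compatible_left_invariant_def compatible_metric_def T)
  define S where "S = {g \<in> carrier G. d g \<one> \<le> \<alpha>}"
  have S: "S \<subseteq> carrier G" and S_inv: "\<And>s. s \<in> S \<Longrightarrow> inv s \<in> S"
    by (auto simp: S_def inv_one)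
  \<comment> \<open>Otherwise a sequence in \<open>S\<close> with \<delta>-distance to the identity
    exceeding \<open>n\<close> tends to infinity, witnessed by \<delta> itself; properness then
    contradicts the bound \<alpha> on \<open>S\<close>. The sign of \<open>B\<close> is for
    multiplying inequalities by it later.\<close>
  have "\<exists>B\<ge>0. \<forall>s\<in>S. \<delta> s \<one> \<le> B"
  proof (rule ccontr)
    assume "\<nexists>B. B \<ge> 0 \<and> (\<forall>s\<in>S. \<delta> s \<one> \<le> B)"
    then have "\<forall>n::nat. \<exists>s\<in>S. \<delta> s \<one> > n"
      by (meson not_le of_nat_0_le_iff)
    then obtain s where s: "\<And>n::nat. s n \<in> S" "\<And>n. \<delta> (s n) \<one> > n"
      by metis
    have "filterlim (\<lambda>n. \<delta> (s n) \<one>) at_top sequentially"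
      by (rule filterlim_at_top_mono[OF filterlim_real_sequentially])
        (use s(2) in \<open>auto intro!: always_eventually less_imp_le\<close>)
    then have "filterlim (\<lambda>n. d (s n) \<one>) at_top sequentially"
      using proper s(1) S \<delta> unfolding metrically_proper_def tends_to_infinity_def by blast
    then have "eventually (\<lambda>n. d (s n) \<one> > \<alpha>) sequentially"
      by (simp add: filterlim_at_top_dense)
    moreover have "\<not> d (s n) \<one> > \<alpha>" for n
      using s(1)[of n] by (simp add: S_def)
    ultimately show False
      by simp
  qed
  then obtain B where B: "B \<ge> 0" "\<And>s. s \<in> S \<Longrightarrow> \<delta> s \<one> \<le> B"
    by blast
  obtain K where K: "\<And>g h. g \<in> carrier G \<Longrightarrow> h \<in> carrier G \<Longrightarrow>
      word_metric G S g h \<le> K * d g h + K"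
    using qi unfolding quasi_isometric_metrics_def S_def by blast
  have "\<delta> g h \<le> B * K * d g h + B * K" if gh: "g \<in> carrier G" "h \<in> carrier G" for g h
  proof -
    have "inv h \<otimes> g \<in> generate G S"
      using gen gh by (simp add: S_def)
    then obtain ss where ss: "set ss \<subseteq> S" "inv h \<otimes> g = word_prod ss"
      using generate_imp_word[OF _ S S_inv] by blast
    have "g = h \<otimes> word_prod ss"
      using gh by (simp flip: ss(2) m_assoc)
    then obtain ts where
      ts: "length ts = word_metric G S g h" "set ts \<subseteq> S" "g = h \<otimes> word_prod ts"
      using word_metric_attained[OF ss(1)] by blast
    then have "\<delta> g h \<le> B * word_metric G S g h"
      using D.word_prod_le[of ts S B h] S gh B(2) by simp
    also have "\<dots> \<le> B * (K * d g h + K)"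
      using K gh B(1) by (intro mult_left_mono)
    finally show ?thesis
      by (simp add: algebra_simps)
  qed
  then show "\<exists>K. \<forall>g\<in>carrier G. \<forall>h\<in>carrier G. \<delta> g h \<le> K * d g h + K"
    by blast
qed

end

theorem proposition2:
  fixes G :: "('a, 'b) monoid_scheme" and T :: "'a topology" and d :: "'a \<Rightarrow> 'a \<Rightarrow> real"
  assumes "metrisable_topological_group G T"
    and "compatible_left_invariant G T d"
    and "metrically_proper G T d"
  shows "(maximal_metric G T d \<longleftrightarrow> large_scale_geodesic (carrier G) d) \<and>
    (large_scale_geodesic (carrier G) d \<longleftrightarrow>
      (\<exists>\<alpha>>0. let \<Sigma> = {g \<in> carrier G. d g \<one>\<^bsub>G\<^esub> \<le> \<alpha>} in
         generate G \<Sigma> = carrier G \<and>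
         quasi_isometric_metrics (carrier G) d (\<lambda>g h. real (word_metric G \<Sigma> g h))))"
    (is "(?max \<longleftrightarrow> ?geod) \<and> (?geod \<longleftrightarrow> ?word)")
proof -
  interpret metrisable_topological_group G T
    by (rule assms(1))
  interpret left_invariant_metric G d
    using assms(2)
    by (simp add: left_invariant_metric_def left_invariant_metric_axioms_def group_axioms
        compatible_left_invariant_def compatible_metric_def topspace_eq_carrier)
  have T: "T = mtopology"
    using assms(2)
    by (simp add: compatible_left_invariant_def compatible_metric_def topspace_eq_carrier)
  have "?max \<Longrightarrow> ?geod"
    using maximal_imp_large_scale_geodesic T by simp
  moreover have "?geod \<Longrightarrow> ?word"
    unfolding Let_def by (erule large_scale_geodesic_imp_word_metric) blast
  moreover have "?word \<Longrightarrow> ?max"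
    unfolding Let_def using word_metric_imp_maximal[OF assms(3)] topspace_eq_carrier by blast
  ultimately show ?thesis
    by blast
qed

end
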